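(* Let $S\equiv(S,\cdot,I,\lambda,\rho)$ be a partial semigroup, let $i,j\in I$, let $a\in S_{ji}$ be sandwich-regular, and let $b\in V(a)$. Let $x\in P^a$, write $\overline{x}=axa$, and put $r=|\widehat{H}_x^a/\mathscr R^a|$ and $l=|\widehat{H}_x^a/\mathscr L^a|$. Then (i) the restriction to $H_x^a$ of the map $\phi:P^a\to W$, $y\mapsto aya$, is a bijection $\phi|_{H_x^a}:H_x^a\to H_{\overline{x}}^b$; (ii) $H_x^a$ is a group if and only if $H_{\overline{x}}^b$ is a group, in which case these groups are isomorphic; (iii) if $H_x^a$ is a group, then $\widehat{H}_x^a$ is an $r\times l$ rectangular group over $H_x^a$; (iv) if $H_x^a$ is a group, then $E_a(\widehat{H}_x^a)$ is an $r\times l$ rectangular band.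
   Context: A partial semigroup is a 5-tuple $(S,\cdot,I,\lambda,\rho)$ consisting of a class $S$, a partial binary operation $(x,y)\mapsto x\cdot y=xy$, a class $I$, and functions $\lambda,\rho:S\to I$ such that for all $x,y,z\in S$: (1) $xy$ is defined iff $x\rho=y\lambda$; (2) if $xy$ is defined then $(xy)\lambda=x\lambda$ and $(xy)\rho=y\rho$; (3) if $xy$ and $yz$ are defined then $(xy)z=x(yz)$; (4) for all $i,j\in I$, $S_{ij}=\{x\in S: x\lambda=i,\ x\rho=j\}$ is a set. For $x\in S$, $V(x)=\{y\in S: x=xyx,\ y=yxy\}$. $\operatorname{Reg}(S)=\{x\in S: x=xyx \text{ for some } y\in S\}$; likewise for semigroups. For $a\in S_{ji}$, the sandwich semigroup is $S_{ij}^a=(S_{ij},\star_a)$, where $x\star_a y=xay$; similarly, for $b\in S_{ij}$, $S_{ji}^b=(S_{ji},\star_b)$. A regular element $a\in S_{ji}$ is sandwich-regular if $aS_{ij}a\subseteq\operatorname{Reg}(S)$. Assume $a$ is sandwich-regular and $b\in V(a)$ (so $b\in S_{ij}$). Write $P^a=\operatorname{Reg}(S_{ij}^a)$, which is a subsemigroup of $S_{ij}^a$, and $W=(aS_{ij}a,\circledast)$, where $u\circledast v=ubv$, i.e. $axa\circledast aya=axaya$; $W$ is a regular monoid with identity $a$, a subsemigroup of $S_{ji}^b$, with underlying set $aP^aa$. The map $\phi:P^a\to W$, $x\mapsto\overline{x}=axa$, is an epimorphism. Green's relations $\mathscr R^a,\mathscr L^a,\mathscr H^a$ are those of the semigroup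 $S_{ij}^a$; on $P^a$ they coincide with those of $P^a$. $H_x^a$ is the $\mathscr H^a$-class of $x$; for $x\in P^a$ it is contained in $P^a$. $H_{\overline{x}}^b$ is the $\mathscr H$-class of $\overline{x}$ in $S_{ji}^b$; it coincides with the $\mathscr H$-class of $\overline{x}$ in $W$. For $x\in P^a$, $\widehat{H}_x^a=\{y\in P^a : \overline{y} \text{ and } \overline{x} \text{ are } \mathscr H\text{-related in } W\}$; it is a union of $\mathscr H^a$-classes, and $\widehat{H}_x^a/\mathscr R^a$, $\widehat{H}_x^a/\mathscr L^a$ denote the quotients of the set $\widehat{H}_x^a$ by the restrictions of $\mathscr R^a$, $\mathscr L^a$. For $X\subseteq P^a$, $E_a(X)=\{x\in X:x=xax\}$. Subsets of $P^a$ are considered with the operation $\star_a$, and subsets of $W$ with $\circledast$ (the restriction of $\star_b$). An $r\times l$ rectangular band is a semigroup isomorphic to $A\times B$, with $A,B$ nonempty sets, $|A|=r$, $|B|=l$, and product $(p_1,q_1)(p_2,q_2)=(p_1,q_2)$. An $r\times l$ rectangular group over a group $G$ is a semigroup isomorphic to the direct product of $G$ with an $r\times l$ rectangular band. *)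

theory Defs
  imports "HOL-Algebra.Group"
begin

section \<open>Semigroups with a carrier\<close>

text \<open>
  A semigroup \<open>(A, f)\<close> is represented by a monoid record of HOL-Algebra, so that \<^const>\<open>group\<close>,
  \<^const>\<open>iso\<close> and the direct product can be used directly. Its unit field is the two-sided identity
  of \<open>(A, f)\<close> if there is one and arbitrary otherwise; hence \<open>group (sgrp A f)\<close> says exactly that the
  set \<open>A\<close> is a group under \<open>f\<close>. Homomorphisms and isomorphisms in HOL-Algebra ignore the unit field.
\<close>

definition sgrp :: "'a set \<Rightarrow> ('a \<Rightarrow> 'a \<Rightarrow> 'a) \<Rightarrow> 'a monoid" where
  "sgrp A f = \<lparr>carrier = A, mult = f,
                one = (THE e. e \<in> A \<and> (\<forall>x\<in>A. f e x = x \<and> f x e = x))\<rparr>"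

text \<open>A subset \<open>X\<close> of a semigroup, considered with the same operation.\<close>

definition subsgrp :: "'a monoid \<Rightarrow> 'a set \<Rightarrow> 'a monoid" where
  "subsgrp T X = sgrp X (mult T)"

definition is_semigroup :: "'a monoid \<Rightarrow> bool" where
  "is_semigroup T \<longleftrightarrow>
     (\<forall>x\<in>carrier T. \<forall>y\<in>carrier T. x \<otimes>\<^bsub>T\<^esub> y \<in> carrier T) \<and>
     (\<forall>x\<in>carrier T. \<forall>y\<in>carrier T. \<forall>z\<in>carrier T.
        (x \<otimes>\<^bsub>T\<^esub> y) \<otimes>\<^bsub>T\<^esub> z = x \<otimes>\<^bsub>T\<^esub> (y \<otimes>\<^bsub>T\<^esub> z))"

definition sreg :: "'a monoid \<Rightarrow> 'a set" where
  "sreg T = {x \<in> carrier T. \<exists>y\<in>carrier T. x = x \<otimes>\<^bsub>T\<^esub> y \<otimes>\<^bsub>T\<^esub> x}"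

text \<open>The principal one-sided ideals \<open>x T\<^sup>1\<close> and \<open>T\<^sup>1 x\<close>, and Green's relations.\<close>

definition pright :: "'a monoid \<Rightarrow> 'a \<Rightarrow> 'a set" where
  "pright T x = insert x {x \<otimes>\<^bsub>T\<^esub> t | t. t \<in> carrier T}"

definition pleft :: "'a monoid \<Rightarrow> 'a \<Rightarrow> 'a set" where
  "pleft T x = insert x {t \<otimes>\<^bsub>T\<^esub> x | t. t \<in> carrier T}"

definition green_R :: "'a monoid \<Rightarrow> 'a rel" where
  "green_R T = {(x, y). x \<in> carrier T \<and> y \<in> carrier T \<and> pright T x = pright T y}"

definition green_L :: "'a monoid \<Rightarrow> 'a rel" where
  "green_L T = {(x, y). x \<in> carrier T \<and> y \<in> carrier T \<and> pleft T x = pleft T y}"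

definition green_H :: "'a monoid \<Rightarrow> 'a rel" where
  "green_H T = green_R T \<inter> green_L T"

definition H_class :: "'a monoid \<Rightarrow> 'a \<Rightarrow> 'a set" where
  "H_class T x = green_H T `` {x}"


section \<open>Rectangular bands and rectangular groups\<close>

definition rect_band :: "'c set \<Rightarrow> 'd set \<Rightarrow> ('c \<times> 'd) monoid" where
  "rect_band A B = sgrp (A \<times> B) (\<lambda>(p1, q1) (p2, q2). (p1, q2))"

text \<open>
  The sizes \<open>r\<close> and \<open>l\<close> may be infinite, so they are cardinals in the sense of
  \<^const>\<open>card_of\<close>, and \<open>|A| = r\<close> is expressed by \<^const>\<open>ordIso\<close>. Taking the index sets over the
  types underlying \<open>r\<close> and \<open>l\<close> loses nothing: the field of a cardinal \<open>r\<close> is a set of size \<open>r\<close>.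
\<close>

definition is_rect_band :: "'c rel \<Rightarrow> 'd rel \<Rightarrow> 'a monoid \<Rightarrow> bool" where
  "is_rect_band r l T \<longleftrightarrow> is_semigroup T \<and>
     (\<exists>(A :: 'c set) (B :: 'd set). A \<noteq> {} \<and> B \<noteq> {} \<and>
        (card_of A, r) \<in> ordIso \<and> (card_of B, l) \<in> ordIso \<and> T \<cong> rect_band A B)"

definition is_rect_group_over :: "'c rel \<Rightarrow> 'd rel \<Rightarrow> 'g monoid \<Rightarrow> 'a monoid \<Rightarrow> bool" where
  "is_rect_group_over r l G T \<longleftrightarrow> group G \<and> is_semigroup T \<and>
     (\<exists>(A :: 'c set) (B :: 'd set). A \<noteq> {} \<and> B \<noteq> {} \<and>
        (card_of A, r) \<in> ordIso \<and> (card_of B, l) \<in> ordIso \<and> T \<cong> G \<times>\<times> rect_band A B)"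


section \<open>Partial semigroups\<close>

text \<open>\<open>pmult S x y = None\<close> means that the product \<open>xy\<close> is undefined.\<close>

record ('a, 'i) psg =
  elems :: "'a set"
  pmult :: "'a \<Rightarrow> 'a \<Rightarrow> 'a option"
  idx :: "'i set"
  lam :: "'a \<Rightarrow> 'i"
  rho :: "'a \<Rightarrow> 'i"

definition hom_set :: "('a, 'i) psg \<Rightarrow> 'i \<Rightarrow> 'i \<Rightarrow> 'a set" where
  "hom_set S i j = {x \<in> elems S. lam S x = i \<and> rho S x = j}"

text \<open>
  The requirement that every \<^const>\<open>hom_set\<close> be a set, rather than a proper class, holds
  automatically in HOL and therefore does not occur below.
\<close>

locale partial_semigroup =
  fixes S :: "('a, 'i) psg"
  assumes lam_idx: "x \<in> elems S \<Longrightarrow> lam S x \<in> idx S"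
    and rho_idx: "x \<in> elems S \<Longrightarrow> rho S x \<in> idx S"
    and pmult_closed: "\<lbrakk>x \<in> elems S; y \<in> elems S; pmult S x y = Some z\<rbrakk> \<Longrightarrow> z \<in> elems S"
    and pmult_defined_iff:
      "\<lbrakk>x \<in> elems S; y \<in> elems S\<rbrakk> \<Longrightarrow> pmult S x y \<noteq> None \<longleftrightarrow> rho S x = lam S y"
    and lam_rho_pmult: "\<lbrakk>x \<in> elems S; y \<in> elems S; pmult S x y = Some z\<rbrakk>
       \<Longrightarrow> lam S z = lam S x \<and> rho S z = rho S y"
    and pmult_assoc: "\<lbrakk>x \<in> elems S; y \<in> elems S; z \<in> elems S;
        pmult S x y = Some u; pmult S y z = Some v\<rbrakk> \<Longrightarrow> pmult S u z = pmult S x v"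

text \<open>The product \<open>xyz = (xy)z\<close>, undefined if one of the two products is.\<close>

definition pmult3 :: "('a, 'i) psg \<Rightarrow> 'a \<Rightarrow> 'a \<Rightarrow> 'a \<Rightarrow> 'a option" where
  "pmult3 S x y z = Option.bind (pmult S x y) (\<lambda>u. pmult S u z)"

definition V :: "('a, 'i) psg \<Rightarrow> 'a \<Rightarrow> 'a set" where
  "V S x = {y \<in> elems S. pmult3 S x y x = Some x \<and> pmult3 S y x y = Some y}"

definition preg :: "('a, 'i) psg \<Rightarrow> 'a set" where
  "preg S = {x \<in> elems S. \<exists>y\<in>elems S. pmult3 S x y x = Some x}"


section \<open>Sandwich semigroups\<close>

text \<open>
  The operation \<open>x \<star>\<^sub>a y = xay\<close> and the map \<open>\<phi>: x \<mapsto> axa\<close>. The products are defined for all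
  \<open>x, y \<in> S\<^sub>i\<^sub>j\<close> if \<open>a \<in> S\<^sub>j\<^sub>i\<close>; elsewhere the values are irrelevant.
\<close>

definition star :: "('a, 'i) psg \<Rightarrow> 'a \<Rightarrow> 'a \<Rightarrow> 'a \<Rightarrow> 'a" where
  "star S a x y = the (pmult3 S x a y)"

definition phi :: "('a, 'i) psg \<Rightarrow> 'a \<Rightarrow> 'a \<Rightarrow> 'a" where
  "phi S a x = the (pmult3 S a x a)"

text \<open>\<open>sandwich S i j a\<close> is \<open>S\<^sub>i\<^sub>j\<^sup>a\<close>, for \<open>a \<in> S\<^sub>j\<^sub>i\<close>.\<close>

definition sandwich :: "('a, 'i) psg \<Rightarrow> 'i \<Rightarrow> 'i \<Rightarrow> 'a \<Rightarrow> 'a monoid" where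
  "sandwich S i j a = sgrp (hom_set S i j) (star S a)"

definition sandwich_regular :: "('a, 'i) psg \<Rightarrow> 'i \<Rightarrow> 'i \<Rightarrow> 'a \<Rightarrow> bool" where
  "sandwich_regular S i j a \<longleftrightarrow>
     a \<in> hom_set S j i \<and> a \<in> preg S \<and> phi S a ` hom_set S i j \<subseteq> preg S"

definition P :: "('a, 'i) psg \<Rightarrow> 'i \<Rightarrow> 'i \<Rightarrow> 'a \<Rightarrow> 'a set" where
  "P S i j a = sreg (sandwich S i j a)"

text \<open>The monoid \<open>(aS\<^sub>i\<^sub>ja, \<circledast>)\<close> with \<open>u \<circledast> v = ubv\<close>.\<close>

definition W :: "('a, 'i) psg \<Rightarrow> 'i \<Rightarrow> 'i \<Rightarrow> 'a \<Rightarrow> 'a \<Rightarrow> 'a monoid" where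
  "W S i j a b = sgrp (phi S a ` hom_set S i j) (star S b)"

definition H_hat :: "('a, 'i) psg \<Rightarrow> 'i \<Rightarrow> 'i \<Rightarrow> 'a \<Rightarrow> 'a \<Rightarrow> 'a \<Rightarrow> 'a set" where
  "H_hat S i j a b x = {y \<in> P S i j a. (phi S a y, phi S a x) \<in> green_H (W S i j a b)}"

definition E :: "('a, 'i) psg \<Rightarrow> 'a \<Rightarrow> 'a set \<Rightarrow> 'a set" where
  "E S a X = {x \<in> X. pmult3 S x a x = Some x}"

end

theory Submission
  imports Defs
begin

text \<open>
  On regular elements, \<open>\<phi>\<close> preserves and reflects the relations \<open>xay \<R> x\<close> and \<open>xay \<L> y\<close>, and it
  is injective on every \<open>\<H>\<close>-class: if \<open>y \<H> z\<close> and \<open>y = yay'ay\<close>, then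
  \<open>z = yay'(aza)y'ay\<close>. This gives the bijection of \<open>H\<^sub>x\<close> with the \<open>\<H>\<close>-class \<open>K\<close> of \<open>axa\<close>. If \<open>K\<close> is a
  group, then \<open>yaz\<close> is \<open>\<R>\<close>-related to \<open>y\<close> and \<open>\<L>\<close>-related to \<open>z\<close> for all \<open>y, z\<close> in the preimage of
  \<open>K\<close>. Hence mapping \<open>y\<close> to the element of \<open>H\<^sub>x\<close> with the same \<open>\<phi>\<close>-value, its \<open>\<R>\<close>-class
  and its \<open>\<L>\<close>-class is an isomorphism onto a rectangular group, under which the idempotents
  correspond to the elements with trivial group component.
\<close>

section \<open>Semigroups and Green's relations\<close>

lemma sgrp_simps [simp]:
  "carrier (sgrp A f) = A" "mult (sgrp A f) = f"
  by (simp_all add: sgrp_def)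

lemma subsgrp_sgrp [simp]: "subsgrp (sgrp A f) X = sgrp X f"
  by (simp add: subsgrp_def)

text \<open>A two-sided identity is unique, so the definite description in \<open>sgrp\<close>
  returns any identity already at hand.\<close>

lemma sgrp_eq:
  assumes "e \<in> A" "\<And>x. x \<in> A \<Longrightarrow> f e x = x" "\<And>x. x \<in> A \<Longrightarrow> f x e = x"
  shows "sgrp A f = \<lparr>carrier = A, mult = f, one = e\<rparr>"
proof -
  have "e' = e" if "e' \<in> A" "\<forall>x\<in>A. f e' x = x \<and> f x e' = x" for e'
    using that assms by metis
  then have "(THE e. e \<in> A \<and> (\<forall>x\<in>A. f e x = x \<and> f x e = x)) = e"
    using assms by (intro the_equality) blast+
  then show ?thesis
    by (simp add: sgrp_def)
qed

text \<open>Transport along an isomorphism gives a group whose unit is the image of the old one; by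
  \<open>sgrp_eq\<close> this is the unit that \<open>sgrp\<close> chooses.\<close>

lemma group_sgrp_iso:
  assumes "group G" "G \<cong> sgrp A f"
  shows "group (sgrp A f)"
proof -
  obtain h where "h \<in> iso G (sgrp A f)"
    using assms(2) by (auto simp: is_iso_def)
  then have "group (sgrp A f\<lparr>one := h \<one>\<^bsub>G\<^esub>\<rparr>)"
    using group.iso_imp_img_group[OF assms(1)] by blast
  moreover have "sgrp A f\<lparr>one := h \<one>\<^bsub>G\<^esub>\<rparr> = \<lparr>carrier = A, mult = f, one = h \<one>\<^bsub>G\<^esub>\<rparr>"
    by (simp add: sgrp_def)
  ultimately have G: "group \<lparr>carrier = A, mult = f, one = h \<one>\<^bsub>G\<^esub>\<rparr>"
    by simp
  then interpret G: group "\<lparr>carrier = A, mult = f, one = h \<one>\<^bsub>G\<^esub>\<rparr>" .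
  show ?thesis
    using G sgrp_eq[of "h \<one>\<^bsub>G\<^esub>" A f] G.one_closed G.l_one G.r_one by simp
qed

text \<open>Reversing the multiplication exchanges right and left ideals. This turns results on R
  into results on L.\<close>

lemma green_R_opposite: "green_R (sgrp A (\<lambda>x y. f y x)) = green_L (sgrp A f)"
  by (simp add: green_R_def green_L_def pright_def pleft_def)

lemma green_L_opposite: "green_L (sgrp A (\<lambda>x y. f y x)) = green_R (sgrp A f)"
  by (simp add: green_R_def green_L_def pright_def pleft_def)

lemma sreg_opposite:
  assumes "is_semigroup (sgrp A f)"
  shows "sreg (sgrp A (\<lambda>x y. f y x)) = sreg (sgrp A f)"
proof -
  have "f (f x y) x = f x (f y x)" if "x \<in> A" "y \<in> A" for x y
    using assms that by (simp add: is_semigroup_def)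
  then show ?thesis
    by (auto simp: sreg_def)
qed

lemma is_semigroup_opposite:
  assumes "is_semigroup (sgrp A f)"
  shows "is_semigroup (sgrp A (\<lambda>x y. f y x))"
  using assms by (simp add: is_semigroup_def)

lemma sreg_subset: "sreg T \<subseteq> carrier T"
  by (auto simp: sreg_def)

lemma equiv_green_R: "equiv (carrier T) (green_R T)"
  by (rule equivI) (auto simp: green_R_def refl_on_def sym_def trans_def)

lemma equiv_green_L: "equiv (carrier T) (green_L T)"
  by (rule equivI) (auto simp: green_L_def refl_on_def sym_def trans_def)

lemma equiv_green_H: "equiv (carrier T) (green_H T)"
  by (rule equivI) (auto simp: green_H_def green_L_def green_R_def refl_on_def sym_def trans_def)

lemma equiv_Restr: "equiv A r \<Longrightarrow> X \<subseteq> A \<Longrightarrow> equiv X (Restr r X)"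
  unfolding equiv_def refl_on_def sym_def trans_def by blast

lemma green_R_iff:
  assumes T: "is_semigroup T" and x: "x \<in> sreg T"
  shows "(x, y) \<in> green_R T \<longleftrightarrow> y \<in> carrier T \<and>
     (\<exists>s\<in>carrier T. y = x \<otimes>\<^bsub>T\<^esub> s) \<and> (\<exists>s\<in>carrier T. x = y \<otimes>\<^bsub>T\<^esub> s)"
    (is "?lhs \<longleftrightarrow> ?rhs")
proof
  have xT: "x \<in> carrier T"
    using x sreg_subset[of T] by blast
  have xx: "\<exists>s\<in>carrier T. x = x \<otimes>\<^bsub>T\<^esub> s"
  proof -
    obtain y where y: "y \<in> carrier T" "x = x \<otimes>\<^bsub>T\<^esub> y \<otimes>\<^bsub>T\<^esub> x"
      using x by (auto simp: sreg_def)
    moreover have "x \<otimes>\<^bsub>T\<^esub> y \<otimes>\<^bsub>T\<^esub> x = x \<otimes>\<^bsub>T\<^esub> (y \<otimes>\<^bsub>T\<^esub> x)" "y \<otimes>\<^bsub>T\<^esub> x \<in> carrier T"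
      using T xT y(1) by (simp_all add: is_semigroup_def)
    ultimately show ?thesis
      by metis
  qed
  {
    assume ?lhs
    then have "y \<in> carrier T" "y \<in> pright T x" "x \<in> pright T y"
      by (auto simp: green_R_def pright_def)
    then show ?rhs
      using xx by (auto simp: pright_def)
  next
    have sub: "pright T u \<subseteq> pright T v"
      if "u = v \<otimes>\<^bsub>T\<^esub> s" "v \<in> carrier T" "s \<in> carrier T" for u v s
      using that T by (auto simp: pright_def is_semigroup_def)
    assume ?rhs
    then have "pright T x = pright T y"
      using sub xT by (intro subset_antisym) blast+
    with xT \<open>?rhs\<close> show ?lhs
      by (simp add: green_R_def)
  }
qed

text \<open>If \<open>x = xx'x\<close>, \<open>y = xs\<close> and \<open>x = ys'\<close>, then
  \<open>y = xx'y = y(s'x')y\<close>.\<close>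

lemma green_R_sreg:
  assumes T: "is_semigroup T" and x: "x \<in> sreg T" and xy: "(x, y) \<in> green_R T"
  shows "y \<in> sreg T"
proof -
  obtain x' where x': "x' \<in> carrier T" "x = x \<otimes>\<^bsub>T\<^esub> x' \<otimes>\<^bsub>T\<^esub> x"
    using x by (auto simp: sreg_def)
  obtain s s' where s: "y \<in> carrier T" "s \<in> carrier T" "y = x \<otimes>\<^bsub>T\<^esub> s"
      "s' \<in> carrier T" "x = y \<otimes>\<^bsub>T\<^esub> s'"
    using xy green_R_iff[OF T x] by blast
  have xT: "x \<in> carrier T"
    using x sreg_subset[of T] by blast
  have "y = x \<otimes>\<^bsub>T\<^esub> x' \<otimes>\<^bsub>T\<^esub> x \<otimes>\<^bsub>T\<^esub> s"
    using s(3) x'(2) by simp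
  also have "\<dots> = x \<otimes>\<^bsub>T\<^esub> x' \<otimes>\<^bsub>T\<^esub> y"
    using T xT x'(1) s(2) unfolding s(3) by (simp add: is_semigroup_def)
  also have "\<dots> = y \<otimes>\<^bsub>T\<^esub> s' \<otimes>\<^bsub>T\<^esub> x' \<otimes>\<^bsub>T\<^esub> y"
    using s(5) by (rule arg_cong)
  also have "\<dots> = y \<otimes>\<^bsub>T\<^esub> (s' \<otimes>\<^bsub>T\<^esub> x') \<otimes>\<^bsub>T\<^esub> y"
    using T x'(1) s(1,4) by (simp add: is_semigroup_def)
  finally have "y = y \<otimes>\<^bsub>T\<^esub> (s' \<otimes>\<^bsub>T\<^esub> x') \<otimes>\<^bsub>T\<^esub> y" .
  moreover have "s' \<otimes>\<^bsub>T\<^esub> x' \<in> carrier T"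
    using T x'(1) s(1,4) by (simp add: is_semigroup_def)
  ultimately show ?thesis
    using s(1) unfolding sreg_def by blast
qed

lemma green_L_iff:
  assumes "is_semigroup (sgrp A f)" and "x \<in> sreg (sgrp A f)"
  shows "(x, y) \<in> green_L (sgrp A f) \<longleftrightarrow> y \<in> A \<and>
     (\<exists>s\<in>A. y = f s x) \<and> (\<exists>s\<in>A. x = f s y)"
  using green_R_iff[OF is_semigroup_opposite[OF assms(1)], of x y] assms(2)
  unfolding sreg_opposite[OF assms(1)] green_R_opposite[of A f] by simp

section \<open>Recognising rectangular groups\<close>

text \<open>The coordinates of \<open>y\<close> are \<open>h y\<close> and its two classes. A
  product \<open>yz\<close> keeps the R-class of \<open>y\<close> and the L-class of
  \<open>z\<close>, so coordinates multiply as in \<open>G\<close> times a rectangular band. They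
  separate points by \<open>inj\<close>, and surjectivity of \<open>h\<close> realises every triple.
  Idempotents are the elements over the identity of \<open>G\<close>, so the two classes alone
  describe them.\<close>

lemma rect_group_decomposition:
  fixes m :: "'a \<Rightarrow> 'a \<Rightarrow> 'a" and R L :: "'a rel"
  assumes G: "group G"
    and X: "is_semigroup (sgrp X m)" "X \<noteq> {}"
    and R: "equiv X R" and L: "equiv X L"
    and mult_R: "\<And>y z. y \<in> X \<Longrightarrow> z \<in> X \<Longrightarrow> (m y z, y) \<in> R"
    and mult_L: "\<And>y z. y \<in> X \<Longrightarrow> z \<in> X \<Longrightarrow> (m y z, z) \<in> L"
    and hom: "h \<in> hom (sgrp X m) G"
    and surj: "h ` X = carrier G"
    and inj: "\<And>y z. (y, z) \<in> R \<Longrightarrow> (y, z) \<in> L \<Longrightarrow> h y = h z \<Longrightarrow> y = z"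
  shows "is_rect_group_over (card_of (X // R)) (card_of (X // L)) G (sgrp X m)"
    and "is_rect_band (card_of (X // R)) (card_of (X // L)) (sgrp {y \<in> X. m y y = y} m)"
proof -
  interpret G: group G by fact
  have m_closed: "m y z \<in> X" if "y \<in> X" "z \<in> X" for y z
    using X that by (simp add: is_semigroup_def)
  have h_closed: "h y \<in> carrier G" if "y \<in> X" for y
    using surj that by blast
  have h_m: "h (m y z) = h y \<otimes>\<^bsub>G\<^esub> h z" if "y \<in> X" "z \<in> X" for y z
    using hom that by (simp add: hom_def)
  have R_class: "R `` {m y z} = R `` {y}" if "y \<in> X" "z \<in> X" for y z
    using equiv_class_eq[OF R mult_R] that .
  have L_class: "L `` {m y z} = L `` {z}" if "y \<in> X" "z \<in> X" for y z
    using equiv_class_eq[OF L mult_L] that .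
  have inj': "y = z" if "y \<in> X" "z \<in> X" "R `` {y} = R `` {z}" "L `` {y} = L `` {z}" "h y = h z" for y z
    using that inj eq_equiv_class_iff[OF R] eq_equiv_class_iff[OF L] by blast
  have fill: "\<exists>w\<in>X. h w = g \<and> R `` {w} = R `` {y} \<and> L `` {w} = L `` {z}"
    if "g \<in> carrier G" "y \<in> X" "z \<in> X" for g y z
  proof -
    \<comment> \<open>The middle factor \<open>v\<close> is chosen so that \<open>yvz\<close> has
      \<open>h\<close>-value \<open>g\<close>, while the outer factors fix the two classes of
      \<open>yvz\<close>.\<close>
    have "inv\<^bsub>G\<^esub> h y \<otimes>\<^bsub>G\<^esub> g \<otimes>\<^bsub>G\<^esub> inv\<^bsub>G\<^esub> h z \<in> carrier G"
      using that h_closed by simp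
    then obtain v where v: "v \<in> X" "h v = inv\<^bsub>G\<^esub> h y \<otimes>\<^bsub>G\<^esub> g \<otimes>\<^bsub>G\<^esub> inv\<^bsub>G\<^esub> h z"
      using surj by (metis imageE)
    have "h (m y (m v z)) = g"
      using v that h_closed
      by (simp add: h_m m_closed G.m_assoc) (simp flip: G.m_assoc)
    then show ?thesis
      using v that by (intro bexI[of _ "m y (m v z)"]) (auto simp: m_closed R_class L_class)
  qed
  have idem: "m y y = y \<longleftrightarrow> h y = \<one>\<^bsub>G\<^esub>" if "y \<in> X" for y
  proof
    assume "m y y = y"
    then show "h y = \<one>\<^bsub>G\<^esub>"
      using h_m[OF that that] h_closed[OF that] G.l_cancel_one by simp
  next
    \<comment> \<open>Now \<open>yy\<close> and \<open>y\<close> agree in all three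
      coordinates.\<close>
    assume "h y = \<one>\<^bsub>G\<^esub>"
    then show "m y y = y"
      using that by (intro inj') (simp_all add: m_closed R_class L_class h_m)
  qed
  have nonempty: "X // R \<noteq> {}" "X // L \<noteq> {}"
    using X(2) by auto
  let ?\<theta> = "\<lambda>y. (h y, R `` {y}, L `` {y})"
  have "?\<theta> \<in> iso (sgrp X m) (G \<times>\<times> rect_band (X // R) (X // L))"
  proof (rule isoI)
    show "?\<theta> \<in> hom (sgrp X m) (G \<times>\<times> rect_band (X // R) (X // L))"
      by (auto simp: hom_def rect_band_def DirProd_def h_m h_closed R_class L_class quotientI)
    have "?\<theta> ` X = carrier G \<times> X // R \<times> X // L"
    proof (intro equalityI subsetI)
      fix p assume "p \<in> carrier G \<times> X // R \<times> X // L"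
      then obtain g y z where "p = (g, R `` {y}, L `` {z})" "g \<in> carrier G" "y \<in> X" "z \<in> X"
        by (auto simp: quotient_def)
      then show "p \<in> ?\<theta> ` X"
        using fill[of g y z] by force
    qed (auto simp: h_closed quotientI)
    then show "bij_betw ?\<theta> (carrier (sgrp X m)) (carrier (G \<times>\<times> rect_band (X // R) (X // L)))"
      by (auto simp: bij_betw_def inj_on_def rect_band_def intro: inj')
  qed
  then show "is_rect_group_over (card_of (X // R)) (card_of (X // L)) G (sgrp X m)"
    unfolding is_rect_group_over_def
    using G X(1) nonempty
    by (intro conjI exI[of _ "X // R"] exI[of _ "X // L"] card_of_refl is_isoI)
  let ?F = "{y \<in> X. m y y = y}" and ?\<tau> = "\<lambda>y. (R `` {y}, L `` {y})"
  have "?\<tau> \<in> iso (sgrp ?F m) (rect_band (X // R) (X // L))"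
  proof (rule isoI)
    show "?\<tau> \<in> hom (sgrp ?F m) (rect_band (X // R) (X // L))"
      by (auto simp: hom_def rect_band_def R_class L_class quotientI)
    have "?\<tau> ` ?F = X // R \<times> X // L"
    proof (intro equalityI subsetI)
      fix p assume "p \<in> X // R \<times> X // L"
      then obtain y z where p: "p = (R `` {y}, L `` {z})" "y \<in> X" "z \<in> X"
        by (auto simp: quotient_def)
      obtain w where w: "w \<in> X" "h w = \<one>\<^bsub>G\<^esub>" "R `` {w} = R `` {y}" "L `` {w} = L `` {z}"
        using fill[OF G.one_closed p(2,3)] by auto
      then show "p \<in> ?\<tau> ` ?F"
        using p(1) idem[OF w(1)] by (intro image_eqI[of _ _ w]) simp_all
    qed (auto simp: quotientI)
    then show "bij_betw ?\<tau> (carrier (sgrp ?F m)) (carrier (rect_band (X // R) (X // L)))"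
      by (auto simp: bij_betw_def inj_on_def rect_band_def idem intro: inj')
  qed
  moreover have "is_semigroup (sgrp ?F m)"
  proof -
    have "m y z \<in> ?F" if "y \<in> ?F" "z \<in> ?F" for y z
      using that idem[of y] idem[of z] idem[OF m_closed[of y z]] m_closed[of y z] h_m[of y z] by simp
    then show ?thesis
      using X(1) unfolding is_semigroup_def sgrp_simps by blast
  qed
  ultimately show "is_rect_band (card_of (X // R)) (card_of (X // L)) (sgrp ?F m)"
    unfolding is_rect_band_def
    using nonempty
    by (intro conjI exI[of _ "X // R"] exI[of _ "X // L"] card_of_refl is_isoI)
qed

section \<open>Sandwich semigroups through ternary products\<close>

text \<open>
  All products in the theorem have odd length and alternate between \<open>A = S\<^sub>i\<^sub>j\<close> and \<open>C = S\<^sub>j\<^sub>i\<close>,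
  so they are expressed through the ternary product \<open>t x y z = xyz\<close>, which unlike the binary one
  does not leave \<open>A \<union> C\<close>.
\<close>

locale sandwich_pair =
  fixes A C :: "'a set" and t :: "'a \<Rightarrow> 'a \<Rightarrow> 'a \<Rightarrow> 'a" and a b :: 'a
  assumes A_closed [simp]: "x \<in> A \<Longrightarrow> u \<in> C \<Longrightarrow> y \<in> A \<Longrightarrow> t x u y \<in> A"
    and C_closed [simp]: "u \<in> C \<Longrightarrow> x \<in> A \<Longrightarrow> v \<in> C \<Longrightarrow> t u x v \<in> C"
    and A_assoc1: "\<lbrakk>x \<in> A; u \<in> C; y \<in> A; v \<in> C; z \<in> A\<rbrakk> \<Longrightarrow> t (t x u y) v z = t x u (t y v z)"
    and A_assoc2: "\<lbrakk>x \<in> A; u \<in> C; y \<in> A; v \<in> C; z \<in> A\<rbrakk> \<Longrightarrow> t x (t u y v) z = t x u (t y v z)"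
    and C_assoc1: "\<lbrakk>x \<in> C; u \<in> A; y \<in> C; v \<in> A; z \<in> C\<rbrakk> \<Longrightarrow> t (t x u y) v z = t x u (t y v z)"
    and C_assoc2: "\<lbrakk>x \<in> C; u \<in> A; y \<in> C; v \<in> A; z \<in> C\<rbrakk> \<Longrightarrow> t x (t u y v) z = t x u (t y v z)"
    and a [simp]: "a \<in> C" and b [simp]: "b \<in> A"
    and aba: "t a b a = a"
begin

lemmas assoc = A_assoc1 A_assoc2 C_assoc1 C_assoc2

abbreviation "Sa \<equiv> sgrp A (\<lambda>x y. t x a y)"
abbreviation "Sb \<equiv> sgrp C (\<lambda>u v. t u b v)"
abbreviation "\<phi> \<equiv> \<lambda>x. t a x a"
abbreviation "Wm \<equiv> sgrp (\<phi> ` A) (\<lambda>u v. t u b v)"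

text \<open>The axioms and the equation \<open>aba = a\<close> are invariant under reversal of the
  ternary product, so each result on R in this locale has a version for L.\<close>

lemma dual: "sandwich_pair A C (\<lambda>x y z. t z y x) a b"
  by unfold_locales (simp_all add: assoc aba)

lemma semigroup_Sa: "is_semigroup Sa"
  by (auto simp: is_semigroup_def assoc)

lemma semigroup_Sb: "is_semigroup Sb"
  by (auto simp: is_semigroup_def assoc)

text \<open>Rewriting with \<open>assoc\<close> nests brackets to the right and breaks up the factor
  \<open>aba\<close>; in this form it can still be cancelled.\<close>

lemma aba_right: "x \<in> A \<Longrightarrow> t a b (t a x u) = t a x u" if "u \<in> C" for u
  using that by (simp add: aba flip: C_assoc1)

lemma phi_star: "x \<in> A \<Longrightarrow> y \<in> A \<Longrightarrow> \<phi> (t x a y) = t (\<phi> x) b (\<phi> y)"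
  by (simp add: assoc aba_right)

lemma semigroup_W: "is_semigroup Wm"
proof -
  have "t (\<phi> x) b (\<phi> y) \<in> \<phi> ` A" if "x \<in> A" "y \<in> A" for x y
    using that by (auto simp flip: phi_star)
  then show ?thesis
    by (auto simp: is_semigroup_def A_assoc1 A_assoc2 C_assoc1 C_assoc2)
qed

lemma sreg_A: "x \<in> sreg Sa \<Longrightarrow> x \<in> A"
  by (simp add: sreg_def)

lemma sregE:
  assumes "x \<in> sreg Sa"
  obtains x' where "x \<in> A" "x' \<in> A" "t x a (t x' a x) = x"
proof -
  obtain x' where x': "x \<in> A" "x' \<in> A" "x = t (t x a x') a x"
    using assms by (auto simp: sreg_def)
  then have "t x a (t x' a x) = x"
    using A_assoc1[of x a x' a x] by simp
  with x' that show ?thesis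
    by blast
qed

section \<open>Regularity and Green's relations under the map \<open>\<phi>\<close>\<close>

lemma phi_sreg:
  assumes "x \<in> sreg Sa"
  shows "\<phi> x \<in> sreg Sb" "\<phi> x \<in> sreg Wm"
proof -
  obtain x' where x': "x \<in> A" "x' \<in> A" "t x a (t x' a x) = x"
    using assms by (rule sregE)
  have "\<phi> x = t (t (\<phi> x) b (\<phi> x')) b (\<phi> x)"
    using x' by (metis phi_star A_assoc1 A_closed a)
  then show "\<phi> x \<in> sreg Sb" "\<phi> x \<in> sreg Wm"
    using x' by (auto simp: sreg_def)
qed

lemma phi_green_R:
  assumes x: "x \<in> sreg Sa" and xy: "(x, y) \<in> green_R Sa"
  shows "(\<phi> x, \<phi> y) \<in> green_R Sb"
proof -
  have xA: "x \<in> A"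
    using x by (rule sreg_A)
  obtain s s' where s: "y \<in> A" "s \<in> A" "y = t x a s" "s' \<in> A" "x = t y a s'"
    using xy unfolding green_R_iff[OF semigroup_Sa x] sgrp_simps by (elim conjE bexE) (rule that)
  have "\<phi> y = t (\<phi> x) b (\<phi> s)"
    using phi_star[OF xA s(2)] s(3) by simp
  moreover have "\<phi> x = t (\<phi> y) b (\<phi> s')"
    using phi_star[OF s(1,4)] s(5) by simp
  moreover have "\<phi> y \<in> C" "\<phi> s \<in> C" "\<phi> s' \<in> C"
    using s(1,2,4) by simp_all
  ultimately show ?thesis
    unfolding green_R_iff[OF semigroup_Sb phi_sreg(1)[OF x]] sgrp_simps by blast
qed

text \<open>One factorization is built into the form \<open>yaz\<close>. The other is pulled back
  from \<open>Sb\<close>, using regularity of \<open>y\<close> to bring \<open>aya\<close> into an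
  expression for \<open>y\<close>.\<close>

lemma reflect_green_R:
  assumes y: "y \<in> sreg Sa" and z: "z \<in> A"
    and yz: "(\<phi> y, \<phi> (t y a z)) \<in> green_R Sb"
  shows "(y, t y a z) \<in> green_R Sa"
proof -
  obtain y' where y': "y \<in> A" "y' \<in> A" "t y a (t y' a y) = y"
    using y by (rule sregE)
  obtain s where s: "s \<in> C" "\<phi> y = t (\<phi> (t y a z)) b s"
    using yz unfolding green_R_iff[OF semigroup_Sb phi_sreg(1)[OF y]] sgrp_simps by (elim conjE bexE) (rule that)
  \<comment> \<open>Applying \<open>y = yay'ay\<close> twice gives \<open>y = yay'(aya)y'ay\<close>,
    which exposes \<open>\<phi> y\<close>. After substitution the initial \<open>yay'ay\<close>
    collapses to \<open>y\<close> again.\<close>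
  have "y = t y a (t y' (\<phi> y) (t y' a y))"
    using y' by (simp add: assoc)
  also have "\<dots> = t y a (t y' (t (\<phi> (t y a z)) b s) (t y' a y))"
    using s by simp
  also have "\<dots> = t (t y a (t y' a y)) a (t z a (t b s (t y' a y)))"
    using y'(1,2) s(1) z by (simp add: assoc)
  also have "\<dots> = t (t y a z) a (t b s (t y' a y))"
    using y' s(1) z by (simp add: assoc)
  finally have "y = t (t y a z) a (t b s (t y' a y))" .
  moreover have "t y a z \<in> A" "t b s (t y' a y) \<in> A"
    using y'(1,2) s(1) z by simp_all
  ultimately show ?thesis
    using z unfolding green_R_iff[OF semigroup_Sa y] sgrp_simps by blast
qed

text \<open>The preimage of \<open>u\<close> is \<open>xax'ux'ax\<close>. Being R-related to
  \<open>axa\<close>, \<open>u\<close> absorbs \<open>axax'\<close> on the left; being L-related to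
  it, \<open>u\<close> absorbs \<open>x'axa\<close> on the right. Hence applying
  \<open>\<phi>\<close> returns \<open>u\<close>.\<close>

lemma lift_green_R:
  assumes x: "x \<in> sreg Sa" and x': "x' \<in> A" "t x a (t x' a x) = x"
    and u: "(\<phi> x, u) \<in> green_R Sb" "(\<phi> x, u) \<in> green_L Sb"
  shows "\<phi> (t (t x a x') u (t x' a x)) = u"
    and "(x, t (t x a x') u (t x' a x)) \<in> green_R Sa"
proof -
  let ?y = "t (t x a x') u (t x' a x)"
  have xA: "x \<in> A"
    using x by (rule sreg_A)
  note \<phi>x = phi_sreg(1)[OF x]
  obtain s s' where s: "u \<in> C" "s \<in> C" "u = t (\<phi> x) b s" "s' \<in> C" "\<phi> x = t u b s'"
    using u(1) unfolding green_R_iff[OF semigroup_Sb \<phi>x] sgrp_simps by (elim conjE bexE) (rule that)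
  obtain r where r: "r \<in> C" "u = t r b (\<phi> x)"
    using u(2) unfolding green_L_iff[OF semigroup_Sb \<phi>x] sgrp_simps by (elim conjE bexE) (rule that)
  have ul: "t (t a x a) x' u = u"
  proof -
    have "t (t a x a) x' (t (\<phi> x) b s) = t (t a (t x a (t x' a x)) a) b s"
      using xA x'(1) s(2) by (simp add: assoc)
    then show ?thesis
      using s(3) x'(2) by simp
  qed
  have ur: "t u x' (t a x a) = u"
  proof -
    have "t (t r b (\<phi> x)) x' (t a x a) = t r b (t a (t x a (t x' a x)) a)"
      using xA x'(1) r(1) by (simp add: assoc)
    then show ?thesis
      using r(2) x'(2) by simp
  qed
  have "\<phi> ?y = t (t (t a x a) x' u) x' (t a x a)"
    using xA x'(1) s(1) by (simp add: assoc)
  then show "\<phi> ?y = u"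
    by (simp add: ul ur)
  \<comment> \<open>As \<open>axa = ubs'\<close>, the right multiplier \<open>bs'x'ax\<close> takes
    the preimage back to \<open>x\<close>.\<close>
  have "t ?y a (t b s' (t x' a x)) = t (t x a x') (t (t u x' (t a x a)) b s') (t x' a x)"
    using xA x'(1) s(1,4) by (simp add: assoc)
  also have "\<dots> = t (t x a x') (\<phi> x) (t x' a x)"
    using ur s(5) by simp
  also have "\<dots> = t (t x a (t x' a x)) a (t x' a x)"
    using xA x'(1) by (simp add: assoc)
  also have "\<dots> = x"
    using x' by simp
  finally have "x = t ?y a (t b s' (t x' a x))" ..
  moreover have "?y = t x a (t x' u (t x' a x))"
    using xA x'(1) s(1) by (simp add: assoc)
  moreover have "?y \<in> A" "t b s' (t x' a x) \<in> A" "t x' u (t x' a x) \<in> A"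
    using xA x'(1) s(1,4) by simp_all
  ultimately show "(x, ?y) \<in> green_R Sa"
    unfolding green_R_iff[OF semigroup_Sa x] sgrp_simps by blast
qed

text \<open>Since \<open>z\<close> lies in both \<open>yaA\<close> and \<open>Aay\<close>, one has
  \<open>yay'az = z = zay'ay\<close>. Thus \<open>z = yay'(aza)y'ay\<close> depends on
  \<open>z\<close> only through \<open>\<phi> z\<close>, and the same formula recovers
  \<open>y\<close> from \<open>\<phi> y\<close>.\<close>

lemma phi_inj:
  assumes y: "y \<in> sreg Sa" and yz: "(y, z) \<in> green_R Sa" "(y, z) \<in> green_L Sa"
    and eq: "\<phi> y = \<phi> z"
  shows "y = z"
proof -
  obtain y' where y': "y \<in> A" "y' \<in> A" "t y a (t y' a y) = y"
    using y by (rule sregE)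
  obtain s where s: "z \<in> A" "s \<in> A" "z = t y a s"
    using yz(1) unfolding green_R_iff[OF semigroup_Sa y] sgrp_simps by (elim conjE bexE) (rule that)
  obtain r where r: "r \<in> A" "z = t r a y"
    using yz(2) unfolding green_L_iff[OF semigroup_Sa y] sgrp_simps by (elim conjE bexE) (rule that)
  have zl: "t y a (t y' a z) = z"
  proof -
    have "t y a (t y' a (t y a s)) = t (t y a (t y' a y)) a s"
      using y'(1,2) s(2) by (simp add: assoc)
    then show ?thesis
      using s(3) y'(3) by simp
  qed
  have zr: "t z a (t y' a y) = z"
  proof -
    have "t (t r a y) a (t y' a y) = t r a (t y a (t y' a y))"
      using y'(1,2) r(1) by (simp add: assoc)
    then show ?thesis
      using r(2) y'(3) by simp
  qed
  have "z = t (t y a (t y' a z)) a (t y' a y)"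
    by (simp add: zl zr)
  also have "\<dots> = t (t y a y') (\<phi> z) (t y' a y)"
    using y'(1,2) s(1) by (simp add: assoc)
  also have "\<dots> = t (t y a (t y' a y)) a (t y' a y)"
    unfolding eq[symmetric] using y'(1,2) by (simp add: assoc)
  also have "\<dots> = y"
    by (simp add: y'(3))
  finally show ?thesis ..
qed

text \<open>Only the passage from \<open>Sb\<close> to \<open>Wm\<close> needs work: a multiplier in
  \<open>C\<close> must be replaced by one in \<open>aAa\<close>.\<close>

lemma green_R_W:
  assumes x: "x \<in> sreg Sa" and y: "y \<in> A"
  shows "(\<phi> x, \<phi> y) \<in> green_R Wm \<longleftrightarrow> (\<phi> x, \<phi> y) \<in> green_R Sb"
proof -
  have xA: "x \<in> A"
    using x by (rule sreg_A)
  have W_C: "\<phi> ` A \<subseteq> C"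
    by auto
  have into_W: "\<exists>d\<in>\<phi> ` A. \<phi> w = t (\<phi> v) b d"
    if "\<phi> w = t (\<phi> v) b s" "s \<in> C" "v \<in> A" "w \<in> A" for v w s
  proof
    \<comment> \<open>The element \<open>a\<close> is a right identity for \<open>\<phi> w\<close>
      under the product through \<open>b\<close>. Inserting it on both sides of \<open>s\<close>
      turns the multiplier into \<open>absba\<close>, the image of \<open>bsb\<close>.\<close>
    have absorb: "t (\<phi> w) b a = \<phi> w" if "w \<in> A" for w
      using that by (simp add: assoc aba)
    have "\<phi> w = t (t (\<phi> v) b s) b a"
      using absorb[OF that(4)] that(1) by simp
    also have "\<dots> = t (t (t (\<phi> v) b a) b s) b a"
      by (simp only: absorb[OF that(3)])
    also have "\<dots> = t (\<phi> v) b (\<phi> (t b s b))"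
      using that(2,3) by (simp add: assoc)
    finally show "\<phi> w = t (\<phi> v) b (\<phi> (t b s b))" .
  qed (use that in simp)
  show ?thesis
    unfolding green_R_iff[OF semigroup_Sb phi_sreg(1)[OF x]] green_R_iff[OF semigroup_W phi_sreg(2)[OF x]]
      sgrp_simps
    using into_W[OF _ _ xA y] into_W[OF _ _ y xA] W_C y C_closed a by blast
qed

lemma sreg_dual: "sreg (sgrp A (\<lambda>x y. t y a x)) = sreg Sa"
  by (rule sreg_opposite[OF semigroup_Sa])

lemmas phi_green_L =
  sandwich_pair.phi_green_R[OF dual, unfolded sreg_dual green_R_opposite]
lemmas reflect_green_L =
  sandwich_pair.reflect_green_R[OF dual, unfolded sreg_dual green_R_opposite]
lemmas green_L_W =
  sandwich_pair.green_R_W[OF dual, unfolded sreg_dual green_R_opposite]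
text \<open>The lift \<open>xax'ux'ax\<close> reads the same under reversal, so this concerns the
  very element of \<open>lift_green_R\<close>.\<close>

lemmas lift_green_L =
  sandwich_pair.lift_green_R(2)[OF dual, unfolded sreg_dual
      green_R_opposite[of A "\<lambda>x y. t x a y"]
      green_R_opposite[of C "\<lambda>u v. t u b v"] green_L_opposite[of C "\<lambda>u v. t u b v"]]

section \<open>The H-class of \<open>x\<close>, its image \<open>K x\<close>, and the preimage of
  \<open>K x\<close>\<close>

abbreviation "H x \<equiv> H_class Sa x"
abbreviation "K x \<equiv> H_class Sb (\<phi> x)"
abbreviation "Hhat x \<equiv> {y \<in> sreg Sa. (\<phi> y, \<phi> x) \<in> green_H Wm}"

lemma H_sreg: "x \<in> sreg Sa \<Longrightarrow> H x \<subseteq> sreg Sa"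
  using green_R_sreg[OF semigroup_Sa] by (auto simp: H_class_def green_H_def)

text \<open>Images of regular elements have the same Green's relations in \<open>Wm\<close> and
  \<open>Sb\<close>, so the preimage can be computed in \<open>Sb\<close>.\<close>

lemma Hhat_eq:
  assumes "x \<in> sreg Sa"
  shows "Hhat x = {y \<in> sreg Sa. \<phi> y \<in> K x}"
proof -
  have "(\<phi> y, \<phi> x) \<in> green_H Wm \<longleftrightarrow> \<phi> y \<in> K x" if "y \<in> sreg Sa" for y
  proof -
    have "x \<in> A"
      using assms by (rule sreg_A)
    then have "(\<phi> y, \<phi> x) \<in> green_H Wm \<longleftrightarrow> (\<phi> y, \<phi> x) \<in> green_H Sb"
      using that by (simp add: green_H_def green_R_W green_L_W)
    also have "\<dots> \<longleftrightarrow> \<phi> y \<in> K x"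
      using equiv_green_H[of Sb] by (auto simp: H_class_def equiv_def sym_def)
    finally show ?thesis .
  qed
  then show ?thesis
    by blast
qed

lemma phi_bij:
  assumes x: "x \<in> sreg Sa"
  shows "bij_betw \<phi> (H x) (K x)"
proof (rule bij_betwI')
  fix y z assume yz: "y \<in> H x" "z \<in> H x"
  have "(y, z) \<in> green_H Sa"
    using yz equiv_green_H[of Sa] unfolding H_class_def equiv_def sym_def trans_def by blast
  then show "\<phi> y = \<phi> z \<longleftrightarrow> y = z"
    using phi_inj H_sreg[OF x] yz(1) by (auto simp: green_H_def)
next
  fix y assume "y \<in> H x"
  then show "\<phi> y \<in> K x"
    using x phi_green_R phi_green_L by (auto simp: H_class_def green_H_def)
next
  fix u assume "u \<in> K x"
  then have u: "(\<phi> x, u) \<in> green_R Sb" "(\<phi> x, u) \<in> green_L Sb"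
    by (auto simp: H_class_def green_H_def)
  obtain x' where x': "x \<in> A" "x' \<in> A" "t x a (t x' a x) = x"
    using x by (rule sregE)
  \<comment> \<open>The reversed lemma needs the regularity equation bracketed to the left.\<close>
  then have x'': "t (t x a x') a x = x"
    by (simp add: assoc)
  have "u \<in> C"
    using u(1) by (auto simp: green_R_def)
  then have "t (t x a x') u (t x' a x) \<in> H x"
    using lift_green_R(2)[OF x x'(2,3) u] lift_green_L[OF x x'(2) x'' u(2,1)]
    by (auto simp: H_class_def green_H_def)
  then show "\<exists>y\<in>H x. u = \<phi> y"
    using lift_green_R(1)[OF x x'(2,3) u] by (intro bexI[of _ "t (t x a x') u (t x' a x)"]) auto
qed

lemma K_related: "u \<in> K x \<Longrightarrow> v \<in> K x \<Longrightarrow> (u, v) \<in> green_R Sb \<and> (u, v) \<in> green_L Sb"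
  by (auto simp: H_class_def green_H_def green_R_def green_L_def)

text \<open>As the product of images stays in \<open>K x\<close>, the image of \<open>yaz\<close> is
  R-related to \<open>\<phi> y\<close> and L-related to \<open>\<phi> z\<close>; reflection carries
  this back along \<open>\<phi>\<close>.\<close>

lemma star_related:
  assumes y: "y \<in> sreg Sa" "\<phi> y \<in> K x" and z: "z \<in> sreg Sa" "\<phi> z \<in> K x"
    and yz: "t (\<phi> y) b (\<phi> z) \<in> K x"
  shows "(y, t y a z) \<in> green_R Sa" "(z, t y a z) \<in> green_L Sa"
    "t y a z \<in> sreg Sa" "\<phi> (t y a z) \<in> K x"
proof -
  have A: "y \<in> A" "z \<in> A"
    using y(1) z(1) by (simp_all add: sreg_A)
  then show *: "\<phi> (t y a z) \<in> K x"
    using yz phi_star by simp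
  show R: "(y, t y a z) \<in> green_R Sa"
    using reflect_green_R[OF y(1) A(2)] K_related[OF y(2) *] by blast
  show "(z, t y a z) \<in> green_L Sa"
    using reflect_green_L[OF z(1) A(1)] K_related[OF z(2) *] by blast
  show "t y a z \<in> sreg Sa"
    using green_R_sreg[OF semigroup_Sa y(1) R] .
qed

text \<open>Closure is a separate hypothesis because it has two sources: a group structure on
  \<open>H x\<close>, or one on \<open>K x\<close>.\<close>

lemma phi_iso:
  assumes x: "x \<in> sreg Sa" and closed: "\<And>y z. y \<in> H x \<Longrightarrow> z \<in> H x \<Longrightarrow> t y a z \<in> H x"
  shows "\<phi> \<in> iso (sgrp (H x) (\<lambda>x y. t x a y)) (sgrp (K x) (\<lambda>u v. t u b v))"
proof (rule isoI)
  have "y \<in> A" if "y \<in> H x" for y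
    using that by (auto simp: H_class_def green_H_def green_R_def)
  then show "\<phi> \<in> hom (sgrp (H x) (\<lambda>x y. t x a y)) (sgrp (K x) (\<lambda>u v. t u b v))"
    using phi_star bij_betw_apply[OF phi_bij[OF x]] by (auto simp: hom_def)
qed (use phi_bij[OF x] in simp)

lemma group_H_iso:
  assumes "x \<in> sreg Sa" and "group (sgrp (H x) (\<lambda>x y. t x a y))"
  shows "\<phi> \<in> iso (sgrp (H x) (\<lambda>x y. t x a y)) (sgrp (K x) (\<lambda>u v. t u b v))"
proof -
  interpret H: group "sgrp (H x) (\<lambda>x y. t x a y)" by fact
  show ?thesis
    using assms(1) H.m_closed by (intro phi_iso) simp_all
qed

lemma group_H_iff:
  assumes x: "x \<in> sreg Sa"
  shows "group (sgrp (H x) (\<lambda>x y. t x a y)) \<longleftrightarrow> group (sgrp (K x) (\<lambda>u v. t u b v))"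
proof
  assume "group (sgrp (H x) (\<lambda>x y. t x a y))"
  then show "group (sgrp (K x) (\<lambda>u v. t u b v))"
    using group_H_iso[OF x] group_sgrp_iso is_isoI by blast
next
  assume K: "group (sgrp (K x) (\<lambda>u v. t u b v))"
  then interpret K: group "sgrp (K x) (\<lambda>u v. t u b v)" .
  have closed: "t y a z \<in> H x" if "y \<in> H x" "z \<in> H x" for y z
  proof -
    have K: "\<phi> y \<in> K x" "\<phi> z \<in> K x"
      using that bij_betw_apply[OF phi_bij[OF x]] by auto
    have "(y, t y a z) \<in> green_R Sa" "(z, t y a z) \<in> green_L Sa"
      using that H_sreg[OF x] K K.m_closed[of "\<phi> y" "\<phi> z"] star_related[of y x z] by auto
    then show ?thesis
      using that by (auto simp: H_class_def green_H_def green_R_def green_L_def)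
  qed
  define h where "h = inv_into (H x) \<phi>"
  have iso: "\<phi> \<in> iso (sgrp (H x) (\<lambda>x y. t x a y)) (sgrp (K x) (\<lambda>u v. t u b v))"
    using phi_iso[OF x closed] .
  \<comment> \<open>The known group is \<open>K x\<close>, so transport needs an isomorphism out of
    it; the inverse of \<open>\<phi>\<close> inherits multiplicativity.\<close>
  have "h \<in> iso (sgrp (K x) (\<lambda>u v. t u b v)) (sgrp (H x) (\<lambda>x y. t x a y))"
  proof (rule isoI)
    have bij: "bij_betw h (K x) (H x)"
      unfolding h_def by (rule bij_betw_inv_into[OF phi_bij[OF x]])
    have h_eq: "h (\<phi> y) = y" if "y \<in> H x" for y
      unfolding h_def using bij_betw_inv_into_left[OF phi_bij[OF x] that] .
    have "h (t u b v) = t (h u) a (h v)" if "u \<in> K x" "v \<in> K x" for u v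
    proof -
      have "h u \<in> H x" "h v \<in> H x"
        using bij that by (auto dest: bij_betw_apply)
      moreover have "\<phi> (h u) = u" "\<phi> (h v) = v"
        unfolding h_def using that bij_betw_inv_into_right[OF phi_bij[OF x]] by auto
      ultimately have "t u b v = \<phi> (t (h u) a (h v))"
        using iso by (simp add: iso_def hom_def)
      then show ?thesis
        using h_eq closed \<open>h u \<in> H x\<close> \<open>h v \<in> H x\<close> by simp
    qed
    then show "h \<in> hom (sgrp (K x) (\<lambda>u v. t u b v)) (sgrp (H x) (\<lambda>x y. t x a y))"
      using bij by (auto simp: hom_def dest: bij_betw_apply)
    show "bij_betw h (carrier (sgrp (K x) (\<lambda>u v. t u b v))) (carrier (sgrp (H x) (\<lambda>x y. t x a y)))"
      using bij by simp
  qed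
  then show "group (sgrp (H x) (\<lambda>x y. t x a y))"
    using group_sgrp_iso K is_isoI by blast
qed

lemma Hhat_rect:
  assumes x: "x \<in> sreg Sa" and H: "group (sgrp (H x) (\<lambda>x y. t x a y))"
  defines "r \<equiv> card_of (Hhat x // Restr (green_R Sa) (Hhat x))"
    and "l \<equiv> card_of (Hhat x // Restr (green_L Sa) (Hhat x))"
  shows "is_rect_group_over r l (sgrp (H x) (\<lambda>x y. t x a y)) (sgrp (Hhat x) (\<lambda>x y. t x a y))"
    and "is_rect_band r l (sgrp {y \<in> Hhat x. t y a y = y} (\<lambda>x y. t x a y))"
proof -
  interpret K: group "sgrp (K x) (\<lambda>u v. t u b v)"
    using H group_H_iff[OF x] by blast
  note bij = phi_bij[OF x] and hat = Hhat_eq[OF x]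
  have x_hat: "x \<in> Hhat x"
    unfolding hat using x equiv_class_self[OF equiv_green_H[of Sb], of "\<phi> x"] sreg_A[OF x]
    by (simp add: H_class_def)
  have hat_A: "Hhat x \<subseteq> A"
    using sreg_subset[of Sa] by auto
  have star_hat: "(y, t y a z) \<in> green_R Sa" "(z, t y a z) \<in> green_L Sa" "t y a z \<in> Hhat x"
    if "y \<in> Hhat x" "z \<in> Hhat x" for y z
    using that star_related[of y x z] K.m_closed[of "\<phi> y" "\<phi> z"] unfolding hat by auto
  have R: "equiv (Hhat x) (Restr (green_R Sa) (Hhat x))"
    and L: "equiv (Hhat x) (Restr (green_L Sa) (Hhat x))"
    using equiv_Restr[OF equiv_green_R[of Sa]] equiv_Restr[OF equiv_green_L[of Sa]] hat_A by simp_all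
  have semigroup: "is_semigroup (sgrp (Hhat x) (\<lambda>x y. t x a y))"
    using semigroup_Sa star_hat(3) hat_A unfolding is_semigroup_def sgrp_simps by blast
  \<comment> \<open>Composing \<open>\<phi>\<close> with this inverse puts the group coordinate in
    \<open>H x\<close> rather than in \<open>K x\<close>, as the decomposition over
    \<open>H x\<close> requires.\<close>
  define h where "h = inv_into (H x) \<phi>"
  have h: "h \<in> iso (sgrp (K x) (\<lambda>u v. t u b v)) (sgrp (H x) (\<lambda>x y. t x a y))"
    unfolding h_def using group.iso_set_sym[OF H group_H_iso[OF x H]] by simp
  then have h_bij: "bij_betw h (K x) (H x)"
    by (simp add: iso_def)
  have "\<phi> \<in> hom (sgrp (Hhat x) (\<lambda>x y. t x a y)) (sgrp (K x) (\<lambda>u v. t u b v))"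
    using phi_star hat_A unfolding hat by (auto simp: hom_def)
  then have hom: "h \<circ> \<phi> \<in> hom (sgrp (Hhat x) (\<lambda>x y. t x a y)) (sgrp (H x) (\<lambda>x y. t x a y))"
    using h by (auto simp: iso_def intro: hom_compose)
  have "\<phi> ` Hhat x = K x"
    using bij H_sreg[OF x] unfolding hat bij_betw_def by blast
  then have surj: "(h \<circ> \<phi>) ` Hhat x = carrier (sgrp (H x) (\<lambda>x y. t x a y))"
    unfolding image_comp[symmetric] using h_bij by (simp add: bij_betw_def)
  have inj: "y = z" if yz: "(y, z) \<in> Restr (green_R Sa) (Hhat x)"
    "(y, z) \<in> Restr (green_L Sa) (Hhat x)" "(h \<circ> \<phi>) y = (h \<circ> \<phi>) z" for y z
  proof -
    have "\<phi> y \<in> K x" "\<phi> z \<in> K x"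
      using yz unfolding hat by auto
    then have "\<phi> y = \<phi> z"
      using yz(3) h_bij by (auto simp: bij_betw_def dest: inj_onD)
    then show ?thesis
      using phi_inj[of y z] yz by blast
  qed
  have mult: "(t y a z, y) \<in> Restr (green_R Sa) (Hhat x)" "(t y a z, z) \<in> Restr (green_L Sa) (Hhat x)"
    if "y \<in> Hhat x" "z \<in> Hhat x" for y z
    using star_hat[OF that] that equiv_green_R[of Sa] equiv_green_L[of Sa]
    by (auto simp: equiv_def dest: symD)
  note decomp = rect_group_decomposition[OF H semigroup _ R L mult hom surj inj]
  show "is_rect_group_over r l (sgrp (H x) (\<lambda>x y. t x a y)) (sgrp (Hhat x) (\<lambda>x y. t x a y))"
    unfolding r_def l_def using x_hat by (intro decomp(1)) blast+
  show "is_rect_band r l (sgrp {y \<in> Hhat x. t y a y = y} (\<lambda>x y. t x a y))"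
    unfolding r_def l_def using x_hat by (intro decomp(2)) blast+
qed

end

section \<open>Partial semigroups\<close>

context partial_semigroup
begin

abbreviation "mul x y \<equiv> the (pmult S x y)"

lemma mul:
  assumes "x \<in> elems S" "y \<in> elems S" "rho S x = lam S y"
  shows "pmult S x y = Some (mul x y)" "mul x y \<in> elems S"
    "lam S (mul x y) = lam S x" "rho S (mul x y) = rho S y"
proof -
  show *: "pmult S x y = Some (mul x y)"
    using assms pmult_defined_iff by simp
  show "mul x y \<in> elems S" "lam S (mul x y) = lam S x" "rho S (mul x y) = rho S y"
    using pmult_closed[OF assms(1,2) *] lam_rho_pmult[OF assms(1,2) *] by simp_all
qed

lemma mul_assoc:
  assumes "x \<in> elems S" "y \<in> elems S" "z \<in> elems S" "rho S x = lam S y" "rho S y = lam S z"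
  shows "mul (mul x y) z = mul x (mul y z)"
  using pmult_assoc[OF assms(1-3) mul(1) mul(1)] assms by metis

lemma pmult3_eq:
  assumes "x \<in> elems S" "y \<in> elems S" "z \<in> elems S" "rho S x = lam S y" "rho S y = lam S z"
  shows "pmult3 S x y z = Some (mul (mul x y) z)"
proof -
  obtain u where u: "pmult S x y = Some u"
    using mul(1)[OF assms(1,2,4)] by blast
  then have "u \<in> elems S" "rho S u = lam S z"
    using mul(2,4)[OF assms(1,2,4)] assms(5) by simp_all
  then obtain v where "pmult S u z = Some v"
    using mul(1)[of u z] assms(3) by blast
  with u show ?thesis
    by (simp add: pmult3_def)
qed

text \<open>The indices of \<open>b\<close> are forced by definedness: \<open>ab\<close> gives its
  left index, and \<open>(ab)a\<close> its right index, since \<open>ab\<close> and \<open>b\<close>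
  have the same \<open>rho\<close>.\<close>

lemma sandwich_pair:
  assumes a: "a \<in> hom_set S j i" and b: "b \<in> V S a"
  shows "sandwich_pair (hom_set S i j) (hom_set S j i) (\<lambda>x y z. the (pmult3 S x y z)) a b"
proof
  have aba: "b \<in> elems S" "pmult3 S a b a = Some a"
    using b by (auto simp: V_def)
  then obtain c where c: "pmult S a b = Some c" "pmult S c a = Some a"
    by (auto simp: pmult3_def bind_eq_Some_conv)
  have a': "a \<in> elems S" "lam S a = j" "rho S a = i"
    using a by (auto simp: hom_set_def)
  have "lam S b = i"
    using c(1) pmult_defined_iff[OF a'(1) aba(1)] a' by simp
  moreover have "rho S b = j"
    using c pmult_closed[OF a'(1) aba(1) c(1)] lam_rho_pmult[OF a'(1) aba(1) c(1)]
      pmult_defined_iff[of c a] a' by simp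
  ultimately show "b \<in> hom_set S i j"
    using aba(1) by (simp add: hom_set_def)
  show "the (pmult3 S a b a) = a"
    using aba by simp
qed (use a in \<open>simp_all add: hom_set_def pmult3_eq mul(2-4) mul_assoc\<close>)

end

theorem theorem2p14:
  fixes S :: "('a, 'i) psg" and i j :: 'i and a b x :: 'a and r l :: "'a set rel"
  assumes "partial_semigroup S"
    and "i \<in> idx S" and "j \<in> idx S"
    and "a \<in> hom_set S j i"
    and "sandwich_regular S i j a"
    and "b \<in> V S a"
    and "x \<in> P S i j a"
    and "r = card_of (H_hat S i j a b x // Restr (green_R (sandwich S i j a)) (H_hat S i j a b x))"
    and "l = card_of (H_hat S i j a b x // Restr (green_L (sandwich S i j a)) (H_hat S i j a b x))"
  shows
    "bij_betw (phi S a)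
       (H_class (sandwich S i j a) x)
       (H_class (sandwich S j i b) (phi S a x))
     \<and>
     (group (subsgrp (sandwich S i j a) (H_class (sandwich S i j a) x)) \<longleftrightarrow>
      group (subsgrp (sandwich S j i b) (H_class (sandwich S j i b) (phi S a x))))
     \<and>
     (group (subsgrp (sandwich S i j a) (H_class (sandwich S i j a) x)) \<longrightarrow>
      subsgrp (sandwich S i j a) (H_class (sandwich S i j a) x) \<cong>
      subsgrp (sandwich S j i b) (H_class (sandwich S j i b) (phi S a x)))
     \<and>
     (group (subsgrp (sandwich S i j a) (H_class (sandwich S i j a) x)) \<longrightarrow>
      is_rect_group_over r l
        (subsgrp (sandwich S i j a) (H_class (sandwich S i j a) x))
        (subsgrp (sandwich S i j a) (H_hat S i j a b x)))
     \<and>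
     (group (subsgrp (sandwich S i j a) (H_class (sandwich S i j a) x)) \<longrightarrow>
      is_rect_band r l
        (subsgrp (sandwich S i j a) (E S a (H_hat S i j a b x))))"
proof -
  interpret partial_semigroup S by fact
  interpret sandwich_pair "hom_set S i j" "hom_set S j i" "\<lambda>x y z. the (pmult3 S x y z)" a b
    using sandwich_pair assms(4,6) by blast
  have x: "x \<in> sreg Sa"
    using assms(7) by (simp add: P_def sandwich_def star_def[abs_def])
  have S: "sandwich S i j a = Sa" "sandwich S j i b = Sb" "phi S a = \<phi>"
    "H_hat S i j a b x = Hhat x"
    by (simp_all add: sandwich_def W_def H_hat_def P_def star_def[abs_def] phi_def[abs_def])
  \<comment> \<open>The product \<open>yay\<close> is defined, so the default value of
    \<open>the\<close> never interferes.\<close>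
  have "pmult3 S y a y = Some y \<longleftrightarrow> the (pmult3 S y a y) = y" if "y \<in> sreg Sa" for y
    using sreg_A[OF that] a by (simp add: hom_set_def pmult3_eq)
  then have E: "E S a (Hhat x) = {y \<in> Hhat x. the (pmult3 S y a y) = y}"
    by (auto simp: E_def)
  show ?thesis
    using phi_bij[OF x] group_H_iff[OF x] is_isoI[OF group_H_iso[OF x]] Hhat_rect[OF x] E
    unfolding assms(8,9) S subsgrp_sgrp by simp
qed

end
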